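(* Let $\mathcal G=(\mathcal V,\mathcal E)$ be a finite connected undirected graph with a cycle basis $\mathcal C$, and let $v\in\mathcal V$. Let $\mathcal G_v^\star$ be the local dual graph attached to $v$, let $d_v^\star$ be the number of connected components of $\mathcal G_v^\star$ and $\mathcal C_v^\star$ its cyclomatic number. Then the counting number $\kappa_v$ of $v$ satisfies $$\kappa_v=1-d_v^\star+\mathcal C_v^\star .$$
   Context: A cycle basis is a basis over $\mathbb Z_2$ of the cycle space of $\mathcal G$, each element being a simple cycle. Counting numbers: $d^\star_\ell$ is the number of basis cycles containing the edge $\ell$; $\kappa_c=1$ for $c\in\mathcal C$; $\kappa_\ell=1-d_\ell^\star$ for $\ell\in\mathcal E$; $\kappa_v=1-\sum_{c\ni v}\kappa_c-\sum_{\ell\ni v}\kappa_\ell$ for $v\in\mathcal V$ (sums over basis cycles, resp. edges, containing $v$). The local dual graph $\mathcal G_v^\star=(\mathcal V_{v;c}^\star,\mathcal V_{v;t}^\star,\mathcal E_v^\star)$ is the bipartite graph whose vertices are: the basis cycles $c$ containing $v$ (forming $\mathcal V_{v;c}^\star$) and the edges $\ell$ of $\mathcal G$ containing $v$ with $\kappa_\ell\neq0$ (forming $\mathcal V_{v;t}^\star$); $\mathcal E_v^\star$ consists of the pairs $(\ell,c)$ with $\ell\in c$. The cyclomatic number of a graph is (number of edges) $-$ (number of vertices) $+$ (number of connected components). *)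

theory Defs
  imports Main "HOL-Library.Z2" "HOL-Library.Function_Algebras" "HOL-Library.Indicator_Function"
begin

text \<open>
  A finite undirected simple graph is a pair of a vertex set \<open>V\<close> and an edge set \<open>E\<close>,
  an edge being the two-element set of its endpoints.
\<close>

definition finite_ugraph :: "'a set \<Rightarrow> 'a set set \<Rightarrow> bool" where
  "finite_ugraph V E \<longleftrightarrow>
     finite V \<and> (\<forall>e\<in>E. \<exists>u\<in>V. \<exists>w\<in>V. u \<noteq> w \<and> e = {u, w})"

definition reachable :: "'a set \<Rightarrow> 'a set set \<Rightarrow> ('a \<times> 'a) set" where
  "reachable V E = {(u, w). u \<in> V \<and> w \<in> V \<and> (u, w) \<in> {(x, y). {x, y} \<in> E}\<^sup>*}"

definition connected_ugraph :: "'a set \<Rightarrow> 'a set set \<Rightarrow> bool" where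
  "connected_ugraph V E \<longleftrightarrow> V \<noteq> {} \<and> (\<forall>u\<in>V. \<forall>w\<in>V. (u, w) \<in> reachable V E)"

definition components :: "'a set \<Rightarrow> 'a set set \<Rightarrow> 'a set set" where
  "components V E = V // reachable V E"

definition num_components :: "'a set \<Rightarrow> 'a set set \<Rightarrow> nat" where
  "num_components V E = card (components V E)"

definition cyclomatic_number :: "'a set \<Rightarrow> 'a set set \<Rightarrow> int" where
  "cyclomatic_number V E = int (card E) - int (card V) + int (num_components V E)"

text \<open>
  A simple cycle is identified with its set of edges; it visits at least three
  vertices, no vertex twice.
\<close>

definition simple_cycle :: "'a set \<Rightarrow> 'a set set \<Rightarrow> 'a set set \<Rightarrow> bool" where
  "simple_cycle V E c \<longleftrightarrow>
     c \<subseteq> E \<and>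
     (\<exists>p. distinct p \<and> set p \<subseteq> V \<and> 3 \<le> length p \<and>
          c = {{p ! i, p ! (Suc i mod length p)} | i. i < length p})"

definition cycle_vertices :: "'a set set \<Rightarrow> 'a set" where
  "cycle_vertices c = \<Union>c"

text \<open>
  Sets of edges are vectors over the two-element field \<^typ>\<open>bit\<close> through their indicator
  functions, with pointwise operations.
\<close>

definition bit_scale :: "bit \<Rightarrow> ('e \<Rightarrow> bit) \<Rightarrow> 'e \<Rightarrow> bit" where
  "bit_scale a f = (\<lambda>e. a * f e)"

interpretation bit_chains: vector_space bit_scale
  by unfold_locales (auto simp: bit_scale_def fun_eq_iff algebra_simps)

text \<open>The cycle space is the kernel of the boundary map on edge chains modulo 2.\<close>

definition cycle_space :: "'a set \<Rightarrow> 'a set set \<Rightarrow> ('a set \<Rightarrow> bit) set" where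
  "cycle_space V E =
     {f. (\<forall>e. e \<notin> E \<longrightarrow> f e = 0) \<and> (\<forall>v\<in>V. (\<Sum>e | e \<in> E \<and> v \<in> e. f e) = 0)}"

definition cycle_basis :: "'a set \<Rightarrow> 'a set set \<Rightarrow> 'a set set set \<Rightarrow> bool" where
  "cycle_basis V E C \<longleftrightarrow>
     (\<forall>c\<in>C. simple_cycle V E c) \<and>
     bit_chains.independent (indicator ` C :: ('a set \<Rightarrow> bit) set) \<and>
     bit_chains.span (indicator ` C) = cycle_space V E"

definition edge_degree :: "'a set set set \<Rightarrow> 'a set \<Rightarrow> nat" where
  "edge_degree C l = card {c \<in> C. l \<in> c}"

definition kappa_cycle :: "'a set set \<Rightarrow> int" where
  "kappa_cycle c = 1"

definition kappa_edge :: "'a set set set \<Rightarrow> 'a set \<Rightarrow> int" where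
  "kappa_edge C l = 1 - int (edge_degree C l)"

definition kappa_vertex :: "'a set set \<Rightarrow> 'a set set set \<Rightarrow> 'a \<Rightarrow> int" where
  "kappa_vertex E C v =
     1 - (\<Sum>c | c \<in> C \<and> v \<in> cycle_vertices c. kappa_cycle c)
       - (\<Sum>l | l \<in> E \<and> v \<in> l. kappa_edge C l)"

text \<open>
  In the local dual graph at \<open>v\<close>, \<^const>\<open>Inl\<close> tags cycles and \<^const>\<open>Inr\<close> tags edges of
  the original graph.
\<close>

definition dual_cycles :: "'a set set set \<Rightarrow> 'a \<Rightarrow> 'a set set set" where
  "dual_cycles C v = {c \<in> C. v \<in> cycle_vertices c}"

definition dual_links :: "'a set set \<Rightarrow> 'a set set set \<Rightarrow> 'a \<Rightarrow> 'a set set" where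
  "dual_links E C v = {l \<in> E. v \<in> l \<and> kappa_edge C l \<noteq> 0}"

definition dual_vertices :: "'a set set \<Rightarrow> 'a set set set \<Rightarrow> 'a \<Rightarrow> ('a set set + 'a set) set" where
  "dual_vertices E C v = dual_cycles C v <+> dual_links E C v"

definition dual_edges :: "'a set set \<Rightarrow> 'a set set set \<Rightarrow> 'a \<Rightarrow> ('a set set + 'a set) set set" where
  "dual_edges E C v = {{Inr l, Inl c} | l c. l \<in> dual_links E C v \<and> c \<in> dual_cycles C v \<and> l \<in> c}"

end

theory Submission imports Defs begin

text \<open>
  The number of components cancels on the right-hand side, leaving one plus the number of edges
  minus the number of vertices of the local dual graph. Count its edges by their link: a link
  \<open>l\<close> lies on \<^term>\<open>edge_degree C l\<close> basis cycles, all of which pass through \<open>v\<close>, so it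
  contributes minus \<^term>\<open>kappa_edge C l\<close> to edges minus vertices, while the omitted edges of
  the original graph have counting number zero.
\<close>

lemma finite_ugraph_finite_edges:
  assumes "finite_ugraph V E"
  shows "finite E"
proof (rule finite_subset)
  show "E \<subseteq> Pow V" "finite (Pow V)"
    using assms by (fastforce simp: finite_ugraph_def)+
qed

lemma cycle_basis_finite:
  assumes "cycle_basis V E C" and "finite E"
  shows "finite C"
proof (rule finite_subset)
  show "C \<subseteq> Pow E" "finite (Pow E)"
    using assms by (auto simp: cycle_basis_def simple_cycle_def)
qed

lemma card_dual_vertices:
  assumes "finite E" and "finite C"
  shows "card (dual_vertices E C v) = card (dual_cycles C v) + card (dual_links E C v)"
  using assms by (simp add: dual_vertices_def dual_cycles_def dual_links_def card_Plus)

lemma card_dual_edges: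
  assumes "finite E" and "finite C"
  shows "card (dual_edges E C v) = (\<Sum>l\<in>dual_links E C v. edge_degree C l)"
proof -
  let ?S = "SIGMA l:dual_links E C v. {c \<in> C. l \<in> c}"
  let ?f = "\<lambda>(l, c). {Inr l, Inl c} :: ('a set set + 'a set) set"
  \<comment> \<open>\<open>?S\<close> need not demand that \<open>c\<close> pass through
    \<open>v\<close>: this follows from \<open>v \<in> l\<close> and
    \<open>l \<in> c\<close>.\<close>
  have "dual_edges E C v = ?f ` ?S"
    by (auto simp: dual_edges_def dual_links_def dual_cycles_def cycle_vertices_def image_iff)
  \<comment> \<open>The tags \<open>Inr\<close> and \<open>Inl\<close> tell the two ends apart, so
    the unordered pair determines \<open>l\<close> and \<open>c\<close>.\<close>
  moreover have "inj_on ?f ?S"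
    by (auto simp: inj_on_def doubleton_eq_iff)
  ultimately have "card (dual_edges E C v) = card ?S"
    by (simp add: card_image)
  also have "\<dots> = (\<Sum>l\<in>dual_links E C v. edge_degree C l)"
    using assms by (simp add: edge_degree_def dual_links_def)
  finally show ?thesis .
qed

lemma kappa_vertex_eq:
  assumes "finite E"
  shows "kappa_vertex E C v =
    1 - int (card (dual_cycles C v)) - int (card (dual_links E C v))
      + int (\<Sum>l\<in>dual_links E C v. edge_degree C l)"
proof -
  have "(\<Sum>l | l \<in> E \<and> v \<in> l. kappa_edge C l) = (\<Sum>l\<in>dual_links E C v. kappa_edge C l)"
    using assms by (intro sum.mono_neutral_right) (auto simp: dual_links_def)
  also have "\<dots> = int (card (dual_links E C v)) - int (\<Sum>l\<in>dual_links E C v. edge_degree C l)"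
    by (simp add: kappa_edge_def sum_subtractf)
  finally show ?thesis
    by (simp add: kappa_vertex_def kappa_cycle_def dual_cycles_def)
qed

theorem proposition3p3:
  fixes V :: "'a set" and E :: "'a set set" and C :: "'a set set set" and v :: 'a
  assumes "finite_ugraph V E"
    and "connected_ugraph V E"
    and "cycle_basis V E C"
    and "v \<in> V"
  shows "kappa_vertex E C v =
           1 - int (num_components (dual_vertices E C v) (dual_edges E C v))
             + cyclomatic_number (dual_vertices E C v) (dual_edges E C v)"
proof -
  \<comment> \<open>Since \<open>card\<close> is 0 on infinite sets, counting the vertices and edges
    of the dual graph relies on \<open>E\<close> and \<open>C\<close> being finite.\<close>
  have E: "finite E"
    using assms(1) by (rule finite_ugraph_finite_edges)
  have C: "finite C"
    using assms(3) E by (rule cycle_basis_finite)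
  show ?thesis
    by (simp add: cyclomatic_number_def kappa_vertex_eq[OF E] card_dual_vertices[OF E C]
        card_dual_edges[OF E C])
qed

end
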